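(* Let $0 \to V \xrightarrow{i} \widetilde{L} \xrightarrow{p} L \to 0$ be an abelian extension of a Lie-Yamaguti algebra $L$ by $V$, let $s:L\to\widetilde L$ be a section of $p$, and let $(\alpha,\beta)$ be the induced $(2,3)$-cocycle. A compatible pair $(\phi,\psi)\in \mathrm{Aut}(V)\times\mathrm{Aut}(L)$ is inducible if and only if the $(2,3)$-cocycles $$(\alpha,\beta)\quad\text{and}\quad \big(\phi\circ\alpha\circ(\psi^{-1},\psi^{-1}),\ \phi\circ\beta\circ(\psi^{-1},\psi^{-1},\psi^{-1})\big)$$ are cohomologous.
   Context: All vector spaces are over a field $\mathbb{K}$ of characteristic zero. A Lie-Yamaguti algebra is a vector space $L$ with a bilinear operation $[\cdot,\cdot]$ and a trilinear operation $\{\cdot,\cdot,\cdot\}$ such that for all $a,b,c,x,y,z$: (LY1) $[a,b]=-[b,a]$; (LY2) $\{a,b,c\}=-\{b,a,c\}$; (LY3) $[[a,b],c]+\{a,b,c\}+[[b,c],a]+\{b,c,a\}+[[c,a],b]+\{c,a,b\}=0$; (LY4) $\{[a,b],c,x\}+\{[b,c],a,x\}+\{[c,a],b,x\}=0$; (LY5) $\{a,b,[x,y]\}=[\{a,b,x\},y]+[x,\{a,b,y\}]$; (LY6) $\{a,b,\{x,y,z\}\}=\{\{a,b,x\},y,z\}+\{x,\{a,b,y\},z\}+\{x,y,\{a,b,z\}\}$. Morphisms are linear maps preserving both operations; $\mathrm{Aut}$ denotes the group of bijective self-morphisms. An abelian extension of $L$ by $V$ is a short exact sequence $0\to V\xrightarrow{i}\widetilde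 L\xrightarrow{p}L\to 0$ of Lie-Yamaguti algebras such that $V$ (identified with $i(V)$) is an abelian ideal, i.e. an ideal with $[V,V]=0$ and $\{V,V,\widetilde L\}=\{V,\widetilde L,V\}=\{\widetilde L,V,V\}=0$. A section of $p$ is a linear map $s:L\to\widetilde L$ with $p\circ s=\mathrm{id}_L$. The induced representation of $L$ on $V$ (independent of $s$) is $\rho(a)(v)=[s(a),v]$, $D(a,b)(v)=\{s(a),s(b),v\}$, $\theta(a,b)(v)=\{v,s(a),s(b)\}$ (brackets in $\widetilde L$). The induced cocycle is $\alpha(a,b)=[s(a),s(b)]-s([a,b])$, $\beta(a,b,c)=\{s(a),s(b),s(c)\}-s(\{a,b,c\})$. Let $\mathrm{Aut}_V(\widetilde L)=\{\gamma\in\mathrm{Aut}(\widetilde L):\gamma(V)=V\}$ and, for such $\gamma$, $\bar\gamma=p\gamma s\in\mathrm{Aut}(L)$ and $\tau(\gamma)=(\gamma|_V,\bar\gamma)$. A pair $(\phi,\psi)\in\mathrm{Aut}(V)\times\mathrm{Aut}(L)$ is inducible if it lies in $\tau(\mathrm{Aut}_V(\widetilde L))$. It is compatible if for all $a,b\in L$, $v\in V$: $\phi(\rho(a)(v))=\rho(\psi(a))(\phi(v))$, $\phi(D(a,b)(v))=D(\psi(a),\psi(b))(\phi(v))$, $\phi(\theta(a,b)(v))=\theta(\psi(a),\psi(b))(\phi(v))$. Cohomology: a $(2,3)$-cochain is a pair $(f,g)$, $f:L^{\otimes 2}\to V$ and $g:L^{\otimes3}\to V$ linear, with $f(x,x)=0$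 and $g(x,x,y)=0$. For a linear map $\lambda:L\to V$ put $\delta(\lambda)=(\delta_I\lambda,\delta_{II}\lambda)$, where $\delta_I\lambda(a,b)=\rho(a)\lambda(b)-\rho(b)\lambda(a)-\lambda([a,b])$ and $\delta_{II}\lambda(a,b,c)=\theta(b,c)\lambda(a)-\theta(a,c)\lambda(b)+D(a,b)\lambda(c)-\lambda(\{a,b,c\})$. A $(2,3)$-cocycle is a $(2,3)$-cochain $(f,g)$ for which the following four expressions vanish identically: $\delta_I f(a,b,c,d)=-\rho(c)g(a,b,d)+\rho(d)g(a,b,c)+g(a,b,[c,d])+D(a,b)f(c,d)-f(\{a,b,c\},d)-f(c,\{a,b,d\})$; $\delta_{II}g(a,b,c,d,e)=-\theta(d,e)g(a,b,c)+\theta(c,e)g(a,b,d)+D(a,b)g(c,d,e)-D(c,d)g(a,b,e)-g(c,\{a,b,d\},e)-g(c,d,\{a,b,e\})+g(a,b,\{c,d,e\})-g(\{a,b,c\},d,e)$; $\delta_I^\star f(a,b,c)=-\rho(a)f(b,c)-\rho(b)f(c,a)-\rho(c)f(a,b)+f([a,b],c)+f([b,c],a)+f([c,a],b)+g(a,b,c)+g(b,c,a)+g(c,a,b)$; $\delta_{II}^\star g(a,b,c,d)=\theta(a,d)f(b,c)+\theta(b,d)f(c,a)+\theta(c,d)f(a,b)+g([a,b],c,d)+g([b,c],a,d)+g([c,a],b,d)$. Two $(2,3)$-cocycles are cohomologous if their difference equals $\delta(\lambda)$ for some linear $\lambda:L\to V$. *)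

theory Defs
  imports Complex_Main
begin

text \<open>
  The underlying vector space of an algebra is a whole type of class \<open>ab_group_add\<close>; the record
  carries the scalar multiplication and the two operations.
\<close>

record ('k, 'a) ly_structure =
  scal :: "'k \<Rightarrow> 'a \<Rightarrow> 'a"
  bra :: "'a \<Rightarrow> 'a \<Rightarrow> 'a"
  tri :: "'a \<Rightarrow> 'a \<Rightarrow> 'a \<Rightarrow> 'a"

definition bilinear_map ::
  "('k::field \<Rightarrow> 'a::ab_group_add \<Rightarrow> 'a) \<Rightarrow> ('k \<Rightarrow> 'b::ab_group_add \<Rightarrow> 'b) \<Rightarrow> ('a \<Rightarrow> 'a \<Rightarrow> 'b) \<Rightarrow> bool"
  where "bilinear_map sA sB f \<longleftrightarrow>
    (\<forall>y. Vector_Spaces.linear sA sB (\<lambda>x. f x y)) \<and>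
    (\<forall>x. Vector_Spaces.linear sA sB (\<lambda>y. f x y))"

definition trilinear_map ::
  "('k::field \<Rightarrow> 'a::ab_group_add \<Rightarrow> 'a) \<Rightarrow> ('k \<Rightarrow> 'b::ab_group_add \<Rightarrow> 'b)
    \<Rightarrow> ('a \<Rightarrow> 'a \<Rightarrow> 'a \<Rightarrow> 'b) \<Rightarrow> bool"
  where "trilinear_map sA sB g \<longleftrightarrow>
    (\<forall>y z. Vector_Spaces.linear sA sB (\<lambda>x. g x y z)) \<and>
    (\<forall>x z. Vector_Spaces.linear sA sB (\<lambda>y. g x y z)) \<and>
    (\<forall>x y. Vector_Spaces.linear sA sB (\<lambda>z. g x y z))"

locale lie_yamaguti =
  fixes A :: "('k::field_char_0, 'a::ab_group_add) ly_structure"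
  assumes vector_space: "vector_space (scal A)"
    and bilinear: "bilinear_map (scal A) (scal A) (bra A)"
    and trilinear: "trilinear_map (scal A) (scal A) (tri A)"
    and LY1: "bra A a b = - bra A b a"
    and LY2: "tri A a b c = - tri A b a c"
    and LY3: "bra A (bra A a b) c + tri A a b c + bra A (bra A b c) a + tri A b c a
              + bra A (bra A c a) b + tri A c a b = 0"
    and LY4: "tri A (bra A a b) c x + tri A (bra A b c) a x + tri A (bra A c a) b x = 0"
    and LY5: "tri A a b (bra A x y) = bra A (tri A a b x) y + bra A x (tri A a b y)"
    and LY6: "tri A a b (tri A x y z)
              = tri A (tri A a b x) y z + tri A x (tri A a b y) z + tri A x y (tri A a b z)"

definition ly_hom ::
  "('k::field, 'a::ab_group_add) ly_structure \<Rightarrow> ('k, 'b::ab_group_add) ly_structure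
    \<Rightarrow> ('a \<Rightarrow> 'b) set"
  where "ly_hom A B =
    {h. Vector_Spaces.linear (scal A) (scal B) h \<and>
        (\<forall>x y. h (bra A x y) = bra B (h x) (h y)) \<and>
        (\<forall>x y z. h (tri A x y z) = tri B (h x) (h y) (h z))}"

definition ly_aut :: "('k::field, 'a::ab_group_add) ly_structure \<Rightarrow> ('a \<Rightarrow> 'a) set"
  where "ly_aut A = {h \<in> ly_hom A A. bij h}"

definition ly_ideal :: "('k::field, 'a::ab_group_add) ly_structure \<Rightarrow> 'a set \<Rightarrow> bool"
  where "ly_ideal A I \<longleftrightarrow> module.subspace (scal A) I \<and>
    (\<forall>u\<in>I. \<forall>x y. bra A u x \<in> I \<and> bra A x u \<in> I \<and>
       tri A u x y \<in> I \<and> tri A x u y \<in> I \<and> tri A x y u \<in> I)"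

definition abelian_ideal :: "('k::field, 'a::ab_group_add) ly_structure \<Rightarrow> 'a set \<Rightarrow> bool"
  where "abelian_ideal A I \<longleftrightarrow> ly_ideal A I \<and>
    (\<forall>u\<in>I. \<forall>v\<in>I. bra A u v = 0 \<and>
       (\<forall>x. tri A u v x = 0 \<and> tri A u x v = 0 \<and> tri A x u v = 0))"

locale abelian_extension =
  V: lie_yamaguti V + E: lie_yamaguti E + L: lie_yamaguti L
  for V :: "('k::field_char_0, 'v::ab_group_add) ly_structure"
    and E :: "('k, 'e::ab_group_add) ly_structure"
    and L :: "('k, 'l::ab_group_add) ly_structure" +
  fixes i :: "'v \<Rightarrow> 'e" and p :: "'e \<Rightarrow> 'l"
  assumes i_hom: "i \<in> ly_hom V E"
    and p_hom: "p \<in> ly_hom E L"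
    and i_inj: "inj i"
    and exact: "range i = {x. p x = 0}"
    and p_surj: "surj p"
    and abelian: "abelian_ideal E (range i)"

definition linear_section ::
  "('k::field, 'e::ab_group_add) ly_structure \<Rightarrow> ('k, 'l::ab_group_add) ly_structure
    \<Rightarrow> ('e \<Rightarrow> 'l) \<Rightarrow> ('l \<Rightarrow> 'e) \<Rightarrow> bool"
  where "linear_section E L p s \<longleftrightarrow> Vector_Spaces.linear (scal L) (scal E) s \<and> p \<circ> s = id"

text \<open>
  In the induced data, \<open>inv i\<close> expresses the identification of \<open>V\<close> with \<open>range i\<close>: it is only ever
  applied to elements of \<open>range i\<close>.
\<close>

definition ind_rho ::
  "('k, 'e) ly_structure \<Rightarrow> ('v \<Rightarrow> 'e) \<Rightarrow> ('l \<Rightarrow> 'e) \<Rightarrow> 'l \<Rightarrow> 'v \<Rightarrow> 'v"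
  where "ind_rho E i s a v = inv i (bra E (s a) (i v))"

definition ind_D ::
  "('k, 'e) ly_structure \<Rightarrow> ('v \<Rightarrow> 'e) \<Rightarrow> ('l \<Rightarrow> 'e) \<Rightarrow> 'l \<Rightarrow> 'l \<Rightarrow> 'v \<Rightarrow> 'v"
  where "ind_D E i s a b v = inv i (tri E (s a) (s b) (i v))"

definition ind_theta ::
  "('k, 'e) ly_structure \<Rightarrow> ('v \<Rightarrow> 'e) \<Rightarrow> ('l \<Rightarrow> 'e) \<Rightarrow> 'l \<Rightarrow> 'l \<Rightarrow> 'v \<Rightarrow> 'v"
  where "ind_theta E i s a b v = inv i (tri E (i v) (s a) (s b))"

definition ind_alpha ::
  "('k, 'e::ab_group_add) ly_structure \<Rightarrow> ('k, 'l) ly_structure \<Rightarrow> ('v \<Rightarrow> 'e) \<Rightarrow> ('l \<Rightarrow> 'e)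
    \<Rightarrow> 'l \<Rightarrow> 'l \<Rightarrow> 'v"
  where "ind_alpha E L i s a b = inv i (bra E (s a) (s b) - s (bra L a b))"

definition ind_beta ::
  "('k, 'e::ab_group_add) ly_structure \<Rightarrow> ('k, 'l) ly_structure \<Rightarrow> ('v \<Rightarrow> 'e) \<Rightarrow> ('l \<Rightarrow> 'e)
    \<Rightarrow> 'l \<Rightarrow> 'l \<Rightarrow> 'l \<Rightarrow> 'v"
  where "ind_beta E L i s a b c = inv i (tri E (s a) (s b) (s c) - s (tri L a b c))"

definition aut_V :: "('k::field, 'e::ab_group_add) ly_structure \<Rightarrow> ('v \<Rightarrow> 'e) \<Rightarrow> ('e \<Rightarrow> 'e) set"
  where "aut_V E i = {\<gamma> \<in> ly_aut E. \<gamma> ` range i = range i}"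

definition tau ::
  "('v \<Rightarrow> 'e) \<Rightarrow> ('e \<Rightarrow> 'l) \<Rightarrow> ('l \<Rightarrow> 'e) \<Rightarrow> ('e \<Rightarrow> 'e) \<Rightarrow> ('v \<Rightarrow> 'v) \<times> ('l \<Rightarrow> 'l)"
  where "tau i p s \<gamma> = (inv i \<circ> \<gamma> \<circ> i, p \<circ> \<gamma> \<circ> s)"

definition inducible ::
  "('k::field, 'e::ab_group_add) ly_structure \<Rightarrow> ('v \<Rightarrow> 'e) \<Rightarrow> ('e \<Rightarrow> 'l) \<Rightarrow> ('l \<Rightarrow> 'e)
    \<Rightarrow> ('v \<Rightarrow> 'v) \<Rightarrow> ('l \<Rightarrow> 'l) \<Rightarrow> bool"
  where "inducible E i p s \<phi> \<psi> \<longleftrightarrow> (\<phi>, \<psi>) \<in> tau i p s ` aut_V E i"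

definition compatible ::
  "('l \<Rightarrow> 'v \<Rightarrow> 'v) \<Rightarrow> ('l \<Rightarrow> 'l \<Rightarrow> 'v \<Rightarrow> 'v) \<Rightarrow> ('l \<Rightarrow> 'l \<Rightarrow> 'v \<Rightarrow> 'v)
    \<Rightarrow> ('v \<Rightarrow> 'v) \<Rightarrow> ('l \<Rightarrow> 'l) \<Rightarrow> bool"
  where "compatible \<rho> D \<theta> \<phi> \<psi> \<longleftrightarrow>
    (\<forall>a v. \<phi> (\<rho> a v) = \<rho> (\<psi> a) (\<phi> v)) \<and>
    (\<forall>a b v. \<phi> (D a b v) = D (\<psi> a) (\<psi> b) (\<phi> v)) \<and>
    (\<forall>a b v. \<phi> (\<theta> a b v) = \<theta> (\<psi> a) (\<psi> b) (\<phi> v))"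

text \<open>Linear maps on tensor powers of \<open>L\<close> are represented by curried multilinear maps.\<close>

definition cochains23 ::
  "('k::field, 'l::ab_group_add) ly_structure \<Rightarrow> ('k, 'v::ab_group_add) ly_structure
    \<Rightarrow> (('l \<Rightarrow> 'l \<Rightarrow> 'v) \<times> ('l \<Rightarrow> 'l \<Rightarrow> 'l \<Rightarrow> 'v)) set"
  where "cochains23 L V =
    {(f, g). bilinear_map (scal L) (scal V) f \<and> trilinear_map (scal L) (scal V) g \<and>
             (\<forall>x. f x x = 0) \<and> (\<forall>x y. g x x y = 0)}"

definition cobd_I ::
  "('k, 'l) ly_structure \<Rightarrow> ('l \<Rightarrow> 'v::ab_group_add \<Rightarrow> 'v) \<Rightarrow> ('l \<Rightarrow> 'v) \<Rightarrow> 'l \<Rightarrow> 'l \<Rightarrow> 'v"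
  where "cobd_I L \<rho> l a b = \<rho> a (l b) - \<rho> b (l a) - l (bra L a b)"

definition cobd_II ::
  "('k, 'l) ly_structure \<Rightarrow> ('l \<Rightarrow> 'l \<Rightarrow> 'v::ab_group_add \<Rightarrow> 'v) \<Rightarrow> ('l \<Rightarrow> 'l \<Rightarrow> 'v \<Rightarrow> 'v)
    \<Rightarrow> ('l \<Rightarrow> 'v) \<Rightarrow> 'l \<Rightarrow> 'l \<Rightarrow> 'l \<Rightarrow> 'v"
  where "cobd_II L D \<theta> l a b c =
    \<theta> b c (l a) - \<theta> a c (l b) + D a b (l c) - l (tri L a b c)"

definition delta_I ::
  "('k, 'l) ly_structure \<Rightarrow> ('l \<Rightarrow> 'v::ab_group_add \<Rightarrow> 'v) \<Rightarrow> ('l \<Rightarrow> 'l \<Rightarrow> 'v \<Rightarrow> 'v)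
    \<Rightarrow> ('l \<Rightarrow> 'l \<Rightarrow> 'v) \<Rightarrow> ('l \<Rightarrow> 'l \<Rightarrow> 'l \<Rightarrow> 'v) \<Rightarrow> 'l \<Rightarrow> 'l \<Rightarrow> 'l \<Rightarrow> 'l \<Rightarrow> 'v"
  where "delta_I L \<rho> D f g a b c d =
    - \<rho> c (g a b d) + \<rho> d (g a b c) + g a b (bra L c d) + D a b (f c d)
    - f (tri L a b c) d - f c (tri L a b d)"

definition delta_II ::
  "('k, 'l) ly_structure \<Rightarrow> ('l \<Rightarrow> 'l \<Rightarrow> 'v::ab_group_add \<Rightarrow> 'v) \<Rightarrow> ('l \<Rightarrow> 'l \<Rightarrow> 'v \<Rightarrow> 'v)
    \<Rightarrow> ('l \<Rightarrow> 'l \<Rightarrow> 'l \<Rightarrow> 'v) \<Rightarrow> 'l \<Rightarrow> 'l \<Rightarrow> 'l \<Rightarrow> 'l \<Rightarrow> 'l \<Rightarrow> 'v"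
  where "delta_II L D \<theta> g a b c d e =
    - \<theta> d e (g a b c) + \<theta> c e (g a b d) + D a b (g c d e) - D c d (g a b e)
    - g c (tri L a b d) e - g c d (tri L a b e) + g a b (tri L c d e) - g (tri L a b c) d e"

definition delta_I_star ::
  "('k, 'l) ly_structure \<Rightarrow> ('l \<Rightarrow> 'v::ab_group_add \<Rightarrow> 'v)
    \<Rightarrow> ('l \<Rightarrow> 'l \<Rightarrow> 'v) \<Rightarrow> ('l \<Rightarrow> 'l \<Rightarrow> 'l \<Rightarrow> 'v) \<Rightarrow> 'l \<Rightarrow> 'l \<Rightarrow> 'l \<Rightarrow> 'v"
  where "delta_I_star L \<rho> f g a b c =
    - \<rho> a (f b c) - \<rho> b (f c a) - \<rho> c (f a b)
    + f (bra L a b) c + f (bra L b c) a + f (bra L c a) b + g a b c + g b c a + g c a b"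

definition delta_II_star ::
  "('k, 'l) ly_structure \<Rightarrow> ('l \<Rightarrow> 'l \<Rightarrow> 'v::ab_group_add \<Rightarrow> 'v)
    \<Rightarrow> ('l \<Rightarrow> 'l \<Rightarrow> 'v) \<Rightarrow> ('l \<Rightarrow> 'l \<Rightarrow> 'l \<Rightarrow> 'v) \<Rightarrow> 'l \<Rightarrow> 'l \<Rightarrow> 'l \<Rightarrow> 'l \<Rightarrow> 'v"
  where "delta_II_star L \<theta> f g a b c d =
    \<theta> a d (f b c) + \<theta> b d (f c a) + \<theta> c d (f a b)
    + g (bra L a b) c d + g (bra L b c) a d + g (bra L c a) b d"

definition cocycles23 ::
  "('k::field, 'l::ab_group_add) ly_structure \<Rightarrow> ('k, 'v::ab_group_add) ly_structure
    \<Rightarrow> ('l \<Rightarrow> 'v \<Rightarrow> 'v) \<Rightarrow> ('l \<Rightarrow> 'l \<Rightarrow> 'v \<Rightarrow> 'v) \<Rightarrow> ('l \<Rightarrow> 'l \<Rightarrow> 'v \<Rightarrow> 'v)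
    \<Rightarrow> (('l \<Rightarrow> 'l \<Rightarrow> 'v) \<times> ('l \<Rightarrow> 'l \<Rightarrow> 'l \<Rightarrow> 'v)) set"
  where "cocycles23 L V \<rho> D \<theta> =
    {(f, g) \<in> cochains23 L V.
       (\<forall>a b c d. delta_I L \<rho> D f g a b c d = 0) \<and>
       (\<forall>a b c d e. delta_II L D \<theta> g a b c d e = 0) \<and>
       (\<forall>a b c. delta_I_star L \<rho> f g a b c = 0) \<and>
       (\<forall>a b c d. delta_II_star L \<theta> f g a b c d = 0)}"

definition cohomologous23 ::
  "('k::field, 'l::ab_group_add) ly_structure \<Rightarrow> ('k, 'v::ab_group_add) ly_structure
    \<Rightarrow> ('l \<Rightarrow> 'v \<Rightarrow> 'v) \<Rightarrow> ('l \<Rightarrow> 'l \<Rightarrow> 'v \<Rightarrow> 'v) \<Rightarrow> ('l \<Rightarrow> 'l \<Rightarrow> 'v \<Rightarrow> 'v)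
    \<Rightarrow> (('l \<Rightarrow> 'l \<Rightarrow> 'v) \<times> ('l \<Rightarrow> 'l \<Rightarrow> 'l \<Rightarrow> 'v))
    \<Rightarrow> (('l \<Rightarrow> 'l \<Rightarrow> 'v) \<times> ('l \<Rightarrow> 'l \<Rightarrow> 'l \<Rightarrow> 'v)) \<Rightarrow> bool"
  where "cohomologous23 L V \<rho> D \<theta> z z' \<longleftrightarrow>
    z \<in> cocycles23 L V \<rho> D \<theta> \<and> z' \<in> cocycles23 L V \<rho> D \<theta> \<and>
    (\<exists>l. Vector_Spaces.linear (scal L) (scal V) l \<and>
         (\<forall>a b. fst z a b - fst z' a b = cobd_I L \<rho> l a b) \<and>
         (\<forall>a b c. snd z a b c - snd z' a b c = cobd_II L D \<theta> l a b c))"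

definition transport ::
  "('v \<Rightarrow> 'v) \<Rightarrow> ('l \<Rightarrow> 'l) \<Rightarrow> (('l \<Rightarrow> 'l \<Rightarrow> 'v) \<times> ('l \<Rightarrow> 'l \<Rightarrow> 'l \<Rightarrow> 'v))
    \<Rightarrow> (('l \<Rightarrow> 'l \<Rightarrow> 'v) \<times> ('l \<Rightarrow> 'l \<Rightarrow> 'l \<Rightarrow> 'v))"
  where "transport \<phi> \<psi> z =
    (\<lambda>a b. \<phi> (fst z (inv \<psi> a) (inv \<psi> b)),
     \<lambda>a b c. \<phi> (snd z (inv \<psi> a) (inv \<psi> b) (inv \<psi> c)))"

end

theory Submission
  imports Defs
begin

text \<open>
  The theorem is a statement about sections. A section \<open>s\<close> writes every element of the extension
  uniquely as \<open>s a + i v\<close>, and in these coordinates both operations are expressed by the induced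
  representation and the induced cocycle alone (\<open>bra_coordinates\<close>, \<open>tri_coordinates\<close>). Two
  consequences carry the proof.

  First, the sections are exactly the maps \<open>s + i \<circ> l\<close> with \<open>l\<close> linear. Passing from \<open>s\<close> to
  \<open>s + i \<circ> l\<close> keeps the representation and adds \<open>\<delta>(l)\<close> to the cocycle. Hence the cocycles
  cohomologous to \<open>(\<alpha>, \<beta>)\<close> are exactly those induced by sections
  (\<open>cohomologous_iff_induced_by_section\<close>).

  Second, if \<open>\<gamma>\<close> induces \<open>(\<phi>, \<psi>)\<close>, then \<open>\<gamma> \<circ> s \<circ> \<psi>\<inverse>\<close> is a section, and its cocycle is the
  transported one because \<open>\<gamma>\<close> is a morphism. Conversely, if a section \<open>s'\<close> induces the transported
  cocycle, then \<open>s a + i v \<mapsto> s' (\<psi> a) + i (\<phi> v)\<close> is an automorphism: compatibility matches the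
  terms of the two coordinate formulas that involve the representation, and the assumption on
  \<open>s'\<close> matches those that involve the cocycle. So \<open>(\<phi>, \<psi>)\<close> is inducible exactly when the
  transported cocycle is induced by a section (\<open>inducible_iff_transport_induced_by_section\<close>), and
  the two equivalences combine.

  That the cocycles satisfy the cocycle identities is the axioms LY3 to LY6 of the extension,
  evaluated on \<open>s a, s b, \<dots>\<close>, minus the image under \<open>s\<close> of the same axioms of \<open>L\<close>.
\<close>

section \<open>Linear and multilinear maps\<close>

lemma linear_iff_add_scale:
  "Vector_Spaces.linear sA sB f \<longleftrightarrow> vector_space sA \<and> vector_space sB \<and>
     (\<forall>x y. f (x + y) = f x + f y) \<and> (\<forall>c x. f (sA c x) = sB c (f x))"
  by (auto simp: Vector_Spaces.linear_def module_hom_def module_hom_axioms_def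
      vector_space_def module_def)

lemma
  assumes "Vector_Spaces.linear sA sB f"
  shows linear_imp_add: "f (x + y) = f x + f y"
    and linear_imp_diff: "f (x - y) = f x - f y"
    and linear_imp_minus: "f (- x) = - f x"
    and linear_imp_zero: "f 0 = 0"
    and linear_imp_scale: "f (sA c x) = sB c (f x)"
proof -
  interpret Vector_Spaces.linear sA sB f by fact
  show "f (x + y) = f x + f y" "f (x - y) = f x - f y" "f (- x) = - f x" "f 0 = 0"
    "f (sA c x) = sB c (f x)"
    by (simp_all add: add diff neg scale)
qed

lemma linear_inv:
  assumes f: "Vector_Spaces.linear sA sB f" and "bij f"
  shows "Vector_Spaces.linear sB sA (inv f)"
proof -
  have "inv f (x + y) = inv f x + inv f y" for x y
    by (rule inv_f_eq)
      (use assms in \<open>auto simp: linear_imp_add[OF f] bij_is_inj bij_is_surj surj_f_inv_f\<close>)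
  moreover have "inv f (sB c x) = sA c (inv f x)" for c x
    by (rule inv_f_eq)
      (use assms in \<open>auto simp: linear_imp_scale[OF f] bij_is_inj bij_is_surj surj_f_inv_f\<close>)
  ultimately show ?thesis
    using f by (auto simp: linear_iff_add_scale)
qed

lemma ly_homD:
  assumes "h \<in> ly_hom A B"
  shows "Vector_Spaces.linear (scal A) (scal B) h"
    and "h (bra A x y) = bra B (h x) (h y)"
    and "h (tri A x y z) = tri B (h x) (h y) (h z)"
  using assms by (auto simp: ly_hom_def)

context lie_yamaguti
begin

lemma
  shows linear_bra_left: "Vector_Spaces.linear (scal A) (scal A) (\<lambda>x. bra A x y)"
    and linear_bra_right: "Vector_Spaces.linear (scal A) (scal A) (\<lambda>y. bra A x y)"
    and linear_tri_1: "Vector_Spaces.linear (scal A) (scal A) (\<lambda>x. tri A x y z)"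
    and linear_tri_2: "Vector_Spaces.linear (scal A) (scal A) (\<lambda>y. tri A x y z)"
    and linear_tri_3: "Vector_Spaces.linear (scal A) (scal A) (\<lambda>z. tri A x y z)"
  using bilinear trilinear by (auto simp: bilinear_map_def trilinear_map_def)

lemmas expand_add =
  linear_imp_add[OF linear_bra_left] linear_imp_add[OF linear_bra_right]
  linear_imp_add[OF linear_tri_1] linear_imp_add[OF linear_tri_2] linear_imp_add[OF linear_tri_3]

lemmas expand_diff =
  linear_imp_diff[OF linear_bra_left] linear_imp_diff[OF linear_bra_right]
  linear_imp_diff[OF linear_tri_1] linear_imp_diff[OF linear_tri_2] linear_imp_diff[OF linear_tri_3]

lemmas expand_scale =
  linear_imp_scale[OF linear_bra_left] linear_imp_scale[OF linear_bra_right]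
  linear_imp_scale[OF linear_tri_1] linear_imp_scale[OF linear_tri_2]
  linear_imp_scale[OF linear_tri_3]

text \<open>
  Skew-symmetry is turned into vanishing on the diagonal here; characteristic zero is what makes
  \<open>2\<close> invertible.
\<close>

lemma eq_minus_self_imp_zero:
  assumes "x = - (x::'a)" shows "x = 0"
proof -
  interpret vector_space "scal A" by (rule vector_space)
  have "scal A (1 + 1) x = x + x"
    by (simp only: scale_left_distrib scale_one)
  also have "\<dots> = 0"
    using assms by (metis add.right_inverse)
  finally show ?thesis by (simp del: one_add_one)
qed

lemma bra_self: "bra A x x = 0"
  by (rule eq_minus_self_imp_zero) (rule LY1)

lemma tri_self: "tri A x x y = 0"
  by (rule eq_minus_self_imp_zero) (rule LY2)

end

section \<open>Abelian extensions with a section\<close>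

locale split_abelian_extension = abelian_extension V E L i p
  for V :: "('k::field_char_0, 'v::ab_group_add) ly_structure"
    and E :: "('k, 'e::ab_group_add) ly_structure"
    and L :: "('k, 'l::ab_group_add) ly_structure"
    and i p +
  fixes s :: "'l \<Rightarrow> 'e"
  assumes section_s: "linear_section E L p s"
begin

abbreviation "\<rho> \<equiv> ind_rho E i s"
abbreviation "D \<equiv> ind_D E i s"
abbreviation "\<theta> \<equiv> ind_theta E i s"
abbreviation "\<alpha> \<equiv> ind_alpha E L i s"
abbreviation "\<beta> \<equiv> ind_beta E L i s"

lemma linear_s: "Vector_Spaces.linear (scal L) (scal E) s"
  and p_s [simp]: "p (s a) = a"
  using section_s by (auto simp: linear_section_def fun_eq_iff)

lemmas linear_i = ly_homD(1)[OF i_hom]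
lemmas linear_p = ly_homD(1)[OF p_hom]
lemmas p_bra = ly_homD(2)[OF p_hom]
lemmas p_tri = ly_homD(3)[OF p_hom]

lemmas i_simps = linear_imp_add[OF linear_i] linear_imp_diff[OF linear_i]
  linear_imp_minus[OF linear_i] linear_imp_zero[OF linear_i] linear_imp_scale[OF linear_i]
lemmas p_simps = linear_imp_add[OF linear_p] linear_imp_diff[OF linear_p]
  linear_imp_minus[OF linear_p] linear_imp_zero[OF linear_p] linear_imp_scale[OF linear_p]
lemmas s_simps = linear_imp_add[OF linear_s] linear_imp_diff[OF linear_s]
  linear_imp_minus[OF linear_s] linear_imp_zero[OF linear_s] linear_imp_scale[OF linear_s]

lemma p_i [simp]: "p (i v) = 0"
  using exact by blast

lemma i_inv_i: "p x = 0 \<Longrightarrow> i (inv i x) = x"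
  using exact by (simp add: f_inv_into_f)

lemma i_eq_iff: "i u = i v \<longleftrightarrow> u = v"
  using i_inj by (auto simp: inj_def)

lemma eq_zero_if_i_eq_zero: "i u = 0 \<Longrightarrow> u = 0"
  using i_eq_iff[of u 0] by (simp add: i_simps)

lemma linear_if_linear_i:
  assumes "Vector_Spaces.linear (scal L) (scal E) (\<lambda>x. i (f x))"
  shows "Vector_Spaces.linear (scal L) (scal V) f"
  unfolding linear_iff_add_scale
proof (intro conjI allI)
  show "f (x + y) = f x + f y" for x y
    using linear_imp_add[OF assms, of x y] by (simp add: i_eq_iff flip: i_simps)
  show "f (scal L c x) = scal V c (f x)" for c x
    using linear_imp_scale[OF assms, of c x] by (simp add: i_eq_iff flip: i_simps)
qed (rule L.vector_space V.vector_space)+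

lemma bra_in_V: "bra E (i u) x \<in> range i" "bra E x (i u) \<in> range i"
  and tri_in_V: "tri E (i u) x y \<in> range i" "tri E x (i u) y \<in> range i" "tri E x y (i u) \<in> range i"
  using abelian unfolding abelian_ideal_def ly_ideal_def by blast+

lemma bra_VV: "bra E (i u) (i v) = 0"
  and tri_VV: "tri E (i u) (i v) x = 0" "tri E (i u) x (i v) = 0" "tri E x (i u) (i v) = 0"
  using abelian unfolding abelian_ideal_def by blast+

text \<open>
  The induced maps are defined through \<open>inv i\<close>; they are handled only through these images in
  \<open>E\<close>, which exist because \<open>V\<close> is an ideal and because \<open>p\<close> kills the defect of \<open>s\<close>.
\<close>

lemma
  shows i_rho: "i (\<rho> a v) = bra E (s a) (i v)"
    and i_D: "i (D a b v) = tri E (s a) (s b) (i v)"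
    and i_theta: "i (\<theta> a b v) = tri E (i v) (s a) (s b)"
    and i_alpha: "i (\<alpha> a b) = bra E (s a) (s b) - s (bra L a b)"
    and i_beta: "i (\<beta> a b c) = tri E (s a) (s b) (s c) - s (tri L a b c)"
  unfolding ind_rho_def ind_D_def ind_theta_def ind_alpha_def ind_beta_def
  by (simp_all add: bra_in_V tri_in_V f_inv_into_f i_inv_i p_simps p_bra p_tri)

text \<open>
  Expanding the operations multilinearly, the terms with at least two arguments in \<open>V\<close> vanish,
  since \<open>V\<close> is an abelian ideal, and those with one such argument are the induced action. The
  negative signs come from moving the argument in \<open>V\<close> to the slot that the definitions of
  \<open>\<rho>\<close> and \<open>\<theta>\<close> prescribe.
\<close>

lemma bra_coordinates:
  "bra E (s a + i v) (s b + i w) = s (bra L a b) + i (\<alpha> a b + \<rho> a w - \<rho> b v)"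
  using E.LY1[of "i v" "s b"]
  by (simp add: i_simps i_rho i_alpha E.expand_add bra_VV)

lemma tri_coordinates:
  "tri E (s a + i u) (s b + i v) (s c + i w)
   = s (tri L a b c) + i (\<beta> a b c + \<theta> b c u - \<theta> a c v + D a b w)"
  using E.LY2[of "s a" "i v" "s c"]
  by (simp add: i_simps i_beta i_theta i_D E.expand_add tri_VV)

section \<open>The induced cocycle\<close>

lemma alpha_beta_cochain: "(\<alpha>, \<beta>) \<in> cochains23 L V"
proof -
  interpret VE: vector_space "scal E" by (rule E.vector_space)
  note linear_simps = linear_iff_add_scale L.vector_space E.vector_space s_simps
    E.expand_add L.expand_add E.expand_scale L.expand_scale VE.scale_right_diff_distrib
  have "bilinear_map (scal L) (scal V) \<alpha>"
    unfolding bilinear_map_def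
    by (intro conjI allI linear_if_linear_i; simp add: linear_simps i_alpha)
  moreover have "trilinear_map (scal L) (scal V) \<beta>"
    unfolding trilinear_map_def
    by (intro conjI allI linear_if_linear_i; simp add: linear_simps i_beta)
  moreover have "\<alpha> a a = 0" for a
    by (rule eq_zero_if_i_eq_zero) (simp add: i_alpha E.bra_self L.bra_self s_simps)
  moreover have "\<beta> a a b = 0" for a b
    by (rule eq_zero_if_i_eq_zero) (simp add: i_beta E.tri_self L.tri_self s_simps)
  ultimately show ?thesis
    by (simp add: cochains23_def)
qed

text \<open>
  Under the injection \<open>i\<close> each condition becomes an identity in \<open>E\<close> between iterated products of
  elements in the image of \<open>s\<close>: the terms that mix \<open>s\<close> with an operation of \<open>L\<close> cancel, and what
  is left is the axiom for \<open>E\<close> and the image under \<open>s\<close> of the axiom for \<open>L\<close>. The instances of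
  LY1 and LY2 are needed where \<open>\<rho>\<close> or \<open>\<theta>\<close> puts an argument in a different slot than the axiom.
\<close>

lemma alpha_beta_cocycle: "(\<alpha>, \<beta>) \<in> cocycles23 L V \<rho> D \<theta>"
proof -
  have "delta_I L \<rho> D \<alpha> \<beta> a b c d = 0" for a b c d
  proof (rule eq_zero_if_i_eq_zero)
    show "i (delta_I L \<rho> D \<alpha> \<beta> a b c d) = 0"
      using E.LY5[of "s a" "s b" "s c" "s d"] arg_cong[OF L.LY5[of a b c d], of s]
        E.LY1[of "s d" "tri E (s a) (s b) (s c)"] E.LY1[of "s d" "s (tri L a b c)"]
      by (simp add: delta_I_def i_simps s_simps i_rho i_D i_alpha i_beta E.expand_diff)
  qed
  moreover have "delta_II L D \<theta> \<beta> a b c d e = 0" for a b c d e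
  proof (rule eq_zero_if_i_eq_zero)
    show "i (delta_II L D \<theta> \<beta> a b c d e) = 0"
      using E.LY6[of "s a" "s b" "s c" "s d" "s e"] arg_cong[OF L.LY6[of a b c d e], of s]
        E.LY2[of "s c" "tri E (s a) (s b) (s d)" "s e"] E.LY2[of "s c" "s (tri L a b d)" "s e"]
      by (simp add: delta_II_def i_simps s_simps i_theta i_D i_beta E.expand_diff)
  qed
  moreover have "delta_I_star L \<rho> \<alpha> \<beta> a b c = 0" for a b c
  proof (rule eq_zero_if_i_eq_zero)
    have *: "bra E (s z) (bra E (s x) (s y)) = - bra E (bra E (s x) (s y)) (s z)"
      "bra E (s z) (s (bra L x y)) = - bra E (s (bra L x y)) (s z)" for x y z
      by (rule E.LY1)+
    show "i (delta_I_star L \<rho> \<alpha> \<beta> a b c) = 0"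
      using E.LY3[of "s a" "s b" "s c"] arg_cong[OF L.LY3[of a b c], of s]
      by (simp add: delta_I_star_def i_simps s_simps i_rho i_alpha i_beta E.expand_diff *
          algebra_simps)
  qed
  moreover have "delta_II_star L \<theta> \<alpha> \<beta> a b c d = 0" for a b c d
  proof (rule eq_zero_if_i_eq_zero)
    show "i (delta_II_star L \<theta> \<alpha> \<beta> a b c d) = 0"
      using E.LY4[of "s a" "s b" "s c" "s d"] arg_cong[OF L.LY4[of a b c d], of s]
      by (simp add: delta_II_star_def i_simps s_simps i_theta i_alpha i_beta E.expand_diff
          algebra_simps)
  qed
  ultimately show ?thesis
    using alpha_beta_cochain by (simp add: cocycles23_def)
qed

text \<open>
  The cocycle conditions are natural in the pair \<open>(\<phi>, \<psi>)\<close>: compatibility moves \<open>\<phi>\<close> past the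
  representation and \<open>\<psi>\<close> is a morphism, so each condition for the transported pair is \<open>\<phi>\<close>
  applied to the same condition for \<open>(f, g)\<close> at preimages under \<open>\<psi>\<close>.
\<close>

lemma transport_cocycle:
  assumes \<phi>: "\<phi> \<in> ly_aut V" and \<psi>: "\<psi> \<in> ly_aut L"
    and comp: "compatible \<rho> D \<theta> \<phi> \<psi>"
    and fg: "(f, g) \<in> cocycles23 L V \<rho> D \<theta>"
  shows "transport \<phi> \<psi> (f, g) \<in> cocycles23 L V \<rho> D \<theta>"
proof -
  define \<psi>' where "\<psi>' = inv \<psi>"
  define f' where "f' a b = \<phi> (f (\<psi>' a) (\<psi>' b))" for a b
  define g' where "g' a b c = \<phi> (g (\<psi>' a) (\<psi>' b) (\<psi>' c))" for a b c
  have bij: "bij \<psi>" and \<phi>_hom: "\<phi> \<in> ly_hom V V" and \<psi>_hom: "\<psi> \<in> ly_hom L L"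
    using \<phi> \<psi> by (auto simp: ly_aut_def)
  have inverse: "\<psi> (\<psi>' a) = a" "\<psi>' (\<psi> a) = a" for a
    using bij by (simp_all add: \<psi>'_def bij_is_inj bij_is_surj surj_f_inv_f)
  note lin\<phi> = ly_homD(1)[OF \<phi>_hom]
  have lin\<psi>': "Vector_Spaces.linear (scal L) (scal L) \<psi>'"
    unfolding \<psi>'_def by (rule linear_inv[OF ly_homD(1)[OF \<psi>_hom] bij])
  note \<phi>_simps = linear_imp_add[OF lin\<phi>] linear_imp_diff[OF lin\<phi>] linear_imp_minus[OF lin\<phi>]
    linear_imp_zero[OF lin\<phi>] linear_imp_scale[OF lin\<phi>]
  have \<psi>'_bra: "\<psi>' (bra L a b) = bra L (\<psi>' a) (\<psi>' b)" for a b
    by (metis inverse ly_homD(2)[OF \<psi>_hom])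
  have \<psi>'_tri: "\<psi>' (tri L a b c) = tri L (\<psi>' a) (\<psi>' b) (\<psi>' c)" for a b c
    by (metis inverse ly_homD(3)[OF \<psi>_hom])
  have act: "\<rho> a (\<phi> v) = \<phi> (\<rho> (\<psi>' a) v)" "D a b (\<phi> v) = \<phi> (D (\<psi>' a) (\<psi>' b) v)"
    "\<theta> a b (\<phi> v) = \<phi> (\<theta> (\<psi>' a) (\<psi>' b) v)" for a b v
    using comp by (simp_all add: compatible_def inverse)
  note natural = f'_def g'_def act \<psi>'_bra \<psi>'_tri \<phi>_simps
  have "(f', g') \<in> cochains23 L V"
  proof -
    have "(f, g) \<in> cochains23 L V"
      using fg by (simp add: cocycles23_def)
    then show ?thesis
      by (simp add: cochains23_def bilinear_map_def trilinear_map_def linear_iff_add_scale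
          f'_def g'_def \<phi>_simps linear_imp_add[OF lin\<psi>'] linear_imp_scale[OF lin\<psi>'])
  qed
  moreover have "delta_I L \<rho> D f' g' a b c d
      = \<phi> (delta_I L \<rho> D f g (\<psi>' a) (\<psi>' b) (\<psi>' c) (\<psi>' d))" for a b c d
    by (simp add: delta_I_def natural)
  moreover have "delta_II L D \<theta> g' a b c d e
      = \<phi> (delta_II L D \<theta> g (\<psi>' a) (\<psi>' b) (\<psi>' c) (\<psi>' d) (\<psi>' e))" for a b c d e
    by (simp add: delta_II_def natural)
  moreover have "delta_I_star L \<rho> f' g' a b c
      = \<phi> (delta_I_star L \<rho> f g (\<psi>' a) (\<psi>' b) (\<psi>' c))" for a b c
    by (simp add: delta_I_star_def natural)
  moreover have "delta_II_star L \<theta> f' g' a b c d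
      = \<phi> (delta_II_star L \<theta> f g (\<psi>' a) (\<psi>' b) (\<psi>' c) (\<psi>' d))" for a b c d
    by (simp add: delta_II_star_def natural)
  ultimately have "(f', g') \<in> cocycles23 L V \<rho> D \<theta>"
    using fg by (simp add: cocycles23_def \<phi>_simps)
  then show ?thesis
    by (simp add: transport_def f'_def[abs_def] g'_def[abs_def] \<psi>'_def)
qed

section \<open>Change of section\<close>

lemma section_shift:
  assumes "Vector_Spaces.linear (scal L) (scal V) l"
  shows "linear_section E L p (\<lambda>a. s a + i (l a))"
proof -
  interpret VE: vector_space "scal E" by (rule E.vector_space)
  show ?thesis
    using assms linear_s
    by (auto simp: linear_section_def linear_iff_add_scale fun_eq_iff p_simps i_simps
        VE.scale_right_distrib)
qed

lemma section_eq_shift: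
  assumes "linear_section E L p s'"
  obtains l where "Vector_Spaces.linear (scal L) (scal V) l" "s' = (\<lambda>a. s a + i (l a))"
proof
  interpret VE: vector_space "scal E" by (rule E.vector_space)
  define l where "l a = inv i (s' a - s a)" for a
  have lin: "Vector_Spaces.linear (scal L) (scal E) s'" and "p (s' a) = a" for a
    using assms by (auto simp: linear_section_def fun_eq_iff)
  then have i_l: "i (l a) = s' a - s a" for a
    by (simp add: l_def i_inv_i p_simps)
  show "Vector_Spaces.linear (scal L) (scal V) l"
    using lin linear_s
    by (intro linear_if_linear_i)
      (simp add: i_l linear_iff_add_scale VE.scale_right_diff_distrib)
  show "s' = (\<lambda>a. s a + i (l a))"
    by (simp add: i_l)
qed

text \<open>
  These are the coordinate formulas evaluated at \<open>s a + i (l a)\<close>: the coboundary collects the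
  action terms, and the value of \<open>l\<close> at the product comes from subtracting the shifted section.
\<close>

lemma
  fixes l defines "s' \<equiv> \<lambda>a. s a + i (l a)"
  shows alpha_shift: "ind_alpha E L i s' a b = \<alpha> a b + cobd_I L \<rho> l a b"
    and beta_shift: "ind_beta E L i s' a b c = \<beta> a b c + cobd_II L D \<theta> l a b c"
proof -
  have "bra E (s' a) (s' b) - s' (bra L a b) = i (\<alpha> a b + cobd_I L \<rho> l a b)"
    by (simp add: s'_def bra_coordinates cobd_I_def i_simps)
  then show "ind_alpha E L i s' a b = \<alpha> a b + cobd_I L \<rho> l a b"
    by (simp add: ind_alpha_def i_inj)
  have "tri E (s' a) (s' b) (s' c) - s' (tri L a b c) = i (\<beta> a b c + cobd_II L D \<theta> l a b c)"
    by (simp add: s'_def tri_coordinates cobd_II_def i_simps)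
  then show "ind_beta E L i s' a b c = \<beta> a b c + cobd_II L D \<theta> l a b c"
    by (simp add: ind_beta_def i_inj)
qed

text \<open>
  Two sections differ by elements of \<open>V\<close>, which act on \<open>V\<close> as zero.
\<close>

lemma representation_section_independent:
  assumes "linear_section E L p s'"
  shows "ind_rho E i s' = \<rho>" "ind_D E i s' = D" "ind_theta E i s' = \<theta>"
proof -
  obtain l where s': "s' = (\<lambda>a. s a + i (l a))"
    using assms by (rule section_eq_shift)
  show "ind_rho E i s' = \<rho>" "ind_D E i s' = D" "ind_theta E i s' = \<theta>"
    by (simp_all add: fun_eq_iff s' ind_rho_def ind_D_def ind_theta_def E.expand_add bra_VV tri_VV)
qed

text \<open>
  A cocycle differs from \<open>(\<alpha>, \<beta>)\<close> by \<open>\<delta>(l)\<close> exactly when it is induced by the section shifted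
  along \<open>l\<close>. Since the coboundary condition subtracts the second cocycle from the first, the
  shift is by the negative of the map that witnesses it.
\<close>

lemma cohomologous_iff_induced_by_section:
  assumes z: "(f, g) \<in> cocycles23 L V \<rho> D \<theta>"
  shows "cohomologous23 L V \<rho> D \<theta> (\<alpha>, \<beta>) (f, g) \<longleftrightarrow>
    (\<exists>s'. linear_section E L p s' \<and> f = ind_alpha E L i s' \<and> g = ind_beta E L i s')"
proof
  have act_minus: "\<rho> a (- v) = - \<rho> a v" "D a b (- v) = - D a b v" "\<theta> a b (- v) = - \<theta> a b v"
    for a b v
    by (simp_all add: i_simps i_rho i_D i_theta linear_imp_minus[OF E.linear_bra_right]
        linear_imp_minus[OF E.linear_tri_1] linear_imp_minus[OF E.linear_tri_3] flip: i_eq_iff)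
  have cobd_minus: "cobd_I L \<rho> (\<lambda>x. - l x) a b = - cobd_I L \<rho> l a b"
    "cobd_II L D \<theta> (\<lambda>x. - l x) a b c = - cobd_II L D \<theta> l a b c" for l a b c
    by (simp_all add: cobd_I_def cobd_II_def act_minus)
  have linear_minus: "Vector_Spaces.linear (scal L) (scal V) (\<lambda>x. - l x)"
    if "Vector_Spaces.linear (scal L) (scal V) l" for l
  proof -
    interpret VV: vector_space "scal V" by (rule V.vector_space)
    show ?thesis
      using that by (simp add: linear_iff_add_scale)
  qed
  {
    assume "cohomologous23 L V \<rho> D \<theta> (\<alpha>, \<beta>) (f, g)"
    then obtain l where l: "Vector_Spaces.linear (scal L) (scal V) l"
      and "cobd_I L \<rho> l a b = \<alpha> a b - f a b" "cobd_II L D \<theta> l a b c = \<beta> a b c - g a b c" for a b c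
      by (auto simp: cohomologous23_def)
    then have "f = ind_alpha E L i (\<lambda>a. s a + i (- l a))"
      "g = ind_beta E L i (\<lambda>a. s a + i (- l a))"
      by (simp_all add: fun_eq_iff alpha_shift beta_shift cobd_minus)
    then show "\<exists>s'. linear_section E L p s' \<and> f = ind_alpha E L i s' \<and> g = ind_beta E L i s'"
      using section_shift[OF linear_minus[OF l]] by blast
  next
    assume "\<exists>s'. linear_section E L p s' \<and> f = ind_alpha E L i s' \<and> g = ind_beta E L i s'"
    then obtain s' where s': "linear_section E L p s'"
      and fg: "f = ind_alpha E L i s'" "g = ind_beta E L i s'"
      by blast
    obtain l where l: "Vector_Spaces.linear (scal L) (scal V) l" and "s' = (\<lambda>a. s a + i (l a))"
      using s' by (rule section_eq_shift)
    with fg have "\<alpha> a b - f a b = cobd_I L \<rho> (\<lambda>x. - l x) a b"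
      "\<beta> a b c - g a b c = cobd_II L D \<theta> (\<lambda>x. - l x) a b c" for a b c
      by (simp_all add: alpha_shift beta_shift cobd_minus)
    then show "cohomologous23 L V \<rho> D \<theta> (\<alpha>, \<beta>) (f, g)"
      using z alpha_beta_cocycle linear_minus[OF l] by (auto simp: cohomologous23_def)
  }
qed

section \<open>Inducible pairs\<close>

text \<open>
  A morphism \<open>\<gamma>\<close> carries the defect \<open>[s a, s b] - s [a, b]\<close> of \<open>s\<close> to the defect of
  \<open>\<gamma> \<circ> s \<circ> \<psi>\<inverse>\<close> at \<open>\<psi> a, \<psi> b\<close>, and similarly for the ternary operation. On \<open>V\<close>, where the
  defects lie, \<open>\<gamma>\<close> is \<open>\<phi>\<close>.
\<close>

lemma transport_eq_induced_by_conjugate_section: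
  assumes \<psi>: "\<psi> \<in> ly_aut L" and \<gamma>: "\<gamma> \<in> aut_V E i" and tau: "tau i p s \<gamma> = (\<phi>, \<psi>)"
  defines "s' \<equiv> \<gamma> \<circ> s \<circ> inv \<psi>"
  shows "linear_section E L p s'"
    and "transport \<phi> \<psi> (\<alpha>, \<beta>) = (ind_alpha E L i s', ind_beta E L i s')"
proof -
  have bij: "bij \<psi>" and \<psi>_hom: "\<psi> \<in> ly_hom L L"
    using \<psi> by (auto simp: ly_aut_def)
  have \<gamma>_hom: "\<gamma> \<in> ly_hom E E" and \<gamma>_V: "\<gamma> ` range i = range i"
    using \<gamma> by (auto simp: aut_V_def ly_aut_def)
  have inverse: "\<psi> (inv \<psi> a) = a" "inv \<psi> (\<psi> a) = a" for a
    using bij by (simp_all add: bij_is_inj bij_is_surj surj_f_inv_f)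
  note lin\<gamma> = ly_homD(1)[OF \<gamma>_hom]
  have lin_inv: "Vector_Spaces.linear (scal L) (scal L) (inv \<psi>)"
    by (rule linear_inv[OF ly_homD(1)[OF \<psi>_hom] bij])
  have \<psi>_eq: "p (\<gamma> (s a)) = \<psi> a" for a
    using tau by (auto simp: tau_def fun_eq_iff)
  have \<phi>_eq: "i (\<phi> v) = \<gamma> (i v)" for v
  proof -
    have "\<gamma> (i v) \<in> range i" using \<gamma>_V by blast
    then show ?thesis using tau by (auto simp: tau_def f_inv_into_f)
  qed
  show "linear_section E L p s'"
    using lin_inv lin\<gamma> linear_s
    by (auto simp: linear_section_def linear_iff_add_scale s'_def fun_eq_iff \<psi>_eq inverse)
  have inv_bra: "inv \<psi> (bra L a b) = bra L (inv \<psi> a) (inv \<psi> b)" for a b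
    by (metis inverse ly_homD(2)[OF \<psi>_hom])
  have inv_tri: "inv \<psi> (tri L a b c) = tri L (inv \<psi> a) (inv \<psi> b) (inv \<psi> c)" for a b c
    by (metis inverse ly_homD(3)[OF \<psi>_hom])
  have "bra E (s' a) (s' b) - s' (bra L a b) = i (\<phi> (\<alpha> (inv \<psi> a) (inv \<psi> b)))" for a b
    by (simp add: \<phi>_eq i_alpha s'_def inv_bra linear_imp_diff[OF lin\<gamma>] ly_homD(2)[OF \<gamma>_hom])
  moreover have "tri E (s' a) (s' b) (s' c) - s' (tri L a b c)
      = i (\<phi> (\<beta> (inv \<psi> a) (inv \<psi> b) (inv \<psi> c)))" for a b c
    by (simp add: \<phi>_eq i_beta s'_def inv_tri linear_imp_diff[OF lin\<gamma>] ly_homD(3)[OF \<gamma>_hom])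
  ultimately show "transport \<phi> \<psi> (\<alpha>, \<beta>) = (ind_alpha E L i s', ind_beta E L i s')"
    by (simp add: transport_def fun_eq_iff ind_alpha_def ind_beta_def i_inj)
qed

lemma coordinates_exhaust:
  obtains a v where "x = s a + i v"
proof
  show "x = s (p x) + i (inv i (x - s (p x)))"
    by (simp add: i_inv_i p_simps)
qed

text \<open>
  The converse: with \<open>s\<close> on the source and \<open>s'\<close> on the target, the two coordinate formulas agree
  under \<open>a \<mapsto> \<psi> a\<close>, \<open>v \<mapsto> \<phi> v\<close>, so the map that has these coordinates is a morphism.
\<close>

lemma inducible_if_transport_induced_by_section:
  assumes \<phi>: "\<phi> \<in> ly_aut V" and \<psi>: "\<psi> \<in> ly_aut L"
    and comp: "compatible \<rho> D \<theta> \<phi> \<psi>"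
    and s': "linear_section E L p s'"
    and tr: "transport \<phi> \<psi> (\<alpha>, \<beta>) = (ind_alpha E L i s', ind_beta E L i s')"
  shows "inducible E i p s \<phi> \<psi>"
proof -
  interpret S': split_abelian_extension V E L i p s'
    by unfold_locales (rule s')
  interpret VE: vector_space "scal E" by (rule E.vector_space)
  note rep = representation_section_independent[OF s']
  have bij\<phi>: "bij \<phi>" and bij: "bij \<psi>" and \<phi>_hom: "\<phi> \<in> ly_hom V V" and \<psi>_hom: "\<psi> \<in> ly_hom L L"
    using \<phi> \<psi> by (auto simp: ly_aut_def)
  note lin\<phi> = ly_homD(1)[OF \<phi>_hom] and lin\<psi> = ly_homD(1)[OF \<psi>_hom]
  note \<phi>_simps = linear_imp_add[OF lin\<phi>] linear_imp_diff[OF lin\<phi>] linear_imp_zero[OF lin\<phi>]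
    linear_imp_scale[OF lin\<phi>]
  note \<psi>_simps = linear_imp_add[OF lin\<psi>] linear_imp_zero[OF lin\<psi>] linear_imp_scale[OF lin\<psi>]
  have act: "\<phi> (\<rho> a v) = \<rho> (\<psi> a) (\<phi> v)" "\<phi> (D a b v) = D (\<psi> a) (\<psi> b) (\<phi> v)"
    "\<phi> (\<theta> a b v) = \<theta> (\<psi> a) (\<psi> b) (\<phi> v)" for a b v
    using comp by (simp_all add: compatible_def)
  have inverse: "inv \<psi> (\<psi> a) = a" for a
    using bij by (simp add: bij_is_inj)
  \<comment> \<open>evaluating the transported cocycle at images under \<open>\<psi>\<close> removes the inverse\<close>
  have alpha': "S'.\<alpha> (\<psi> a) (\<psi> b) = \<phi> (\<alpha> a b)" for a b
    using tr by (simp add: transport_def inverse fun_eq_iff del: split_paired_All)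
      (metis inverse)
  have beta': "S'.\<beta> (\<psi> a) (\<psi> b) (\<psi> c) = \<phi> (\<beta> a b c)" for a b c
    using tr by (simp add: transport_def inverse fun_eq_iff del: split_paired_All)
      (metis inverse)
  define \<gamma> where "\<gamma> x = s' (\<psi> (p x)) + i (\<phi> (inv i (x - s (p x))))" for x
  have \<gamma>_coord: "\<gamma> (s a + i v) = s' (\<psi> a) + i (\<phi> v)" for a v
    by (simp add: \<gamma>_def p_simps i_inj)
  have add: "\<gamma> (x + y) = \<gamma> x + \<gamma> y" for x y
  proof -
    obtain a v b w where x: "x = s a + i v" "y = s b + i w"
      by (metis coordinates_exhaust)
    have "x + y = s (a + b) + i (v + w)"
      by (simp add: x s_simps i_simps)
    then show ?thesis
      by (simp only: \<gamma>_coord x) (simp add: s_simps S'.s_simps i_simps \<phi>_simps \<psi>_simps)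
  qed
  have scale: "\<gamma> (scal E c x) = scal E c (\<gamma> x)" for c x
  proof -
    obtain a v where x: "x = s a + i v" by (rule coordinates_exhaust)
    have "scal E c x = s (scal L c a) + i (scal V c v)"
      by (simp add: x s_simps i_simps VE.scale_right_distrib)
    then show ?thesis
      by (simp only: \<gamma>_coord x)
        (simp add: S'.s_simps i_simps \<phi>_simps \<psi>_simps VE.scale_right_distrib)
  qed
  have bra: "\<gamma> (bra E x y) = bra E (\<gamma> x) (\<gamma> y)" for x y
  proof -
    obtain a v b w where x: "x = s a + i v" "y = s b + i w"
      by (metis coordinates_exhaust)
    show ?thesis
      by (simp only: x bra_coordinates \<gamma>_coord S'.bra_coordinates rep alpha' \<phi>_simps act
          ly_homD(2)[OF \<psi>_hom])
  qed
  have tri: "\<gamma> (tri E x y z) = tri E (\<gamma> x) (\<gamma> y) (\<gamma> z)" for x y z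
  proof -
    obtain a u b v c w where x: "x = s a + i u" "y = s b + i v" "z = s c + i w"
      by (metis coordinates_exhaust)
    show ?thesis
      by (simp only: x tri_coordinates \<gamma>_coord S'.tri_coordinates rep beta' \<phi>_simps act
          ly_homD(3)[OF \<psi>_hom])
  qed
  have p_\<gamma>: "p (\<gamma> (s a + i v)) = \<psi> a" for a v
    by (simp add: \<gamma>_coord p_simps)
  have \<gamma>_i: "\<gamma> (i v) = i (\<phi> v)" for v
    using \<gamma>_coord[of 0 v] by (simp add: s_simps S'.s_simps \<psi>_simps)
  have "inj \<gamma>"
  proof (rule injI)
    fix x y assume eq: "\<gamma> x = \<gamma> y"
    obtain a v b w where x: "x = s a + i v" "y = s b + i w"
      by (metis coordinates_exhaust)
    have "\<psi> a = \<psi> b"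
      using arg_cong[OF eq, of p] by (simp add: x p_\<gamma>)
    moreover from this have "\<phi> v = \<phi> w"
      using eq by (simp add: x \<gamma>_coord i_eq_iff)
    ultimately show "x = y"
      using bij bij\<phi> by (simp add: x bij_is_inj inj_eq)
  qed
  moreover have "surj \<gamma>"
  proof (rule surjI)
    fix y
    obtain b w where y: "y = s' b + i w" by (rule S'.coordinates_exhaust)
    show "\<gamma> (s (inv \<psi> (p y)) + i (inv \<phi> (inv i (y - s' (p y))))) = y"
      using bij bij\<phi> by (simp add: \<gamma>_coord y p_simps i_inj bij_is_surj surj_f_inv_f)
  qed
  ultimately have "\<gamma> \<in> ly_aut E"
    by (simp add: ly_aut_def ly_hom_def linear_iff_add_scale E.vector_space add scale bra tri
        bij_def)
  moreover have "\<gamma> ` range i = range i"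
  proof -
    have "\<gamma> ` range i = i ` range \<phi>"
      by (simp add: image_image \<gamma>_i)
    then show ?thesis
      using bij\<phi> by (simp add: bij_is_surj)
  qed
  moreover have "tau i p s \<gamma> = (\<phi>, \<psi>)"
  proof -
    have "p (\<gamma> (s a)) = \<psi> a" for a
      using p_\<gamma>[of a 0] by (simp add: i_simps)
    then show ?thesis
      by (simp add: tau_def fun_eq_iff \<gamma>_i i_inj)
  qed
  ultimately have "(\<phi>, \<psi>) = tau i p s \<gamma>" "\<gamma> \<in> aut_V E i"
    by (simp_all add: aut_V_def)
  then show ?thesis
    unfolding inducible_def by (rule image_eqI)
qed

lemma inducible_iff_transport_induced_by_section:
  assumes "\<phi> \<in> ly_aut V" and "\<psi> \<in> ly_aut L" and "compatible \<rho> D \<theta> \<phi> \<psi>"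
  shows "inducible E i p s \<phi> \<psi> \<longleftrightarrow>
    (\<exists>s'. linear_section E L p s' \<and>
       transport \<phi> \<psi> (\<alpha>, \<beta>) = (ind_alpha E L i s', ind_beta E L i s'))"
proof
  assume "inducible E i p s \<phi> \<psi>"
  then obtain \<gamma> where \<gamma>: "\<gamma> \<in> aut_V E i" "tau i p s \<gamma> = (\<phi>, \<psi>)"
    by (auto simp: inducible_def)
  show "\<exists>s'. linear_section E L p s' \<and>
       transport \<phi> \<psi> (\<alpha>, \<beta>) = (ind_alpha E L i s', ind_beta E L i s')"
    using transport_eq_induced_by_conjugate_section[OF assms(2) \<gamma>] by blast
qed (use inducible_if_transport_induced_by_section[OF assms] in blast)

end

section \<open>Inducibility and cohomology\<close>

theorem theorem4p6:
  fixes V :: "('k::field_char_0, 'v::ab_group_add) ly_structure"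
    and E :: "('k, 'e::ab_group_add) ly_structure"
    and L :: "('k, 'l::ab_group_add) ly_structure"
    and i :: "'v \<Rightarrow> 'e" and p :: "'e \<Rightarrow> 'l" and s :: "'l \<Rightarrow> 'e"
    and \<phi> :: "'v \<Rightarrow> 'v" and \<psi> :: "'l \<Rightarrow> 'l"
  defines "\<rho> \<equiv> ind_rho E i s" and "D \<equiv> ind_D E i s" and "\<theta> \<equiv> ind_theta E i s"
    and "\<alpha> \<equiv> ind_alpha E L i s" and "\<beta> \<equiv> ind_beta E L i s"
  assumes "abelian_extension V E L i p"
    and "linear_section E L p s"
    and "\<phi> \<in> ly_aut V" and "\<psi> \<in> ly_aut L"
    and "compatible \<rho> D \<theta> \<phi> \<psi>"
  shows "(\<alpha>, \<beta>) \<in> cocycles23 L V \<rho> D \<theta>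
       \<and> transport \<phi> \<psi> (\<alpha>, \<beta>) \<in> cocycles23 L V \<rho> D \<theta>
       \<and> (inducible E i p s \<phi> \<psi>
          \<longleftrightarrow> cohomologous23 L V \<rho> D \<theta> (\<alpha>, \<beta>) (transport \<phi> \<psi> (\<alpha>, \<beta>)))"
proof -
  interpret split_abelian_extension V E L i p s
    by (intro split_abelian_extension.intro split_abelian_extension_axioms.intro) fact+
  note comp = assms(10)[unfolded \<rho>_def D_def \<theta>_def]
  obtain f g where fg: "transport \<phi> \<psi> (ind_alpha E L i s, ind_beta E L i s) = (f, g)"
    by fastforce
  note z = alpha_beta_cocycle
  note z' = transport_cocycle[OF assms(8,9) comp z, unfolded fg]
  have "inducible E i p s \<phi> \<psi> \<longleftrightarrow>
      (\<exists>s'. linear_section E L p s' \<and> f = ind_alpha E L i s' \<and> g = ind_beta E L i s')"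
    by (simp add: inducible_iff_transport_induced_by_section[OF assms(8,9) comp] fg)
  then show ?thesis
    unfolding \<rho>_def D_def \<theta>_def \<alpha>_def \<beta>_def fg
    using z z' cohomologous_iff_induced_by_section[OF z'] by blast
qed

end
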